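(* Let $r\ge2$ and let $F_r$ be the free group of rank $r$ with the word metric of a fixed free generating set. For integers $n,k\ge0$ define $$\gamma(n,k)=\min\left\{\frac{|UV|}{|U|\,|V|}: \emptyset\ne U\subseteq S_n,\ \emptyset\ne V\subseteq S_k\right\}.$$ Let $(d_j)_{j\ge0}$ be given by $d_0=1$ and $d_j=\frac12+\frac{d_{j-1}}4$ for $j\ge1$, so that $d_j=\frac{2+4^{-j}}3$. Then for all $n\ge k\ge0$, $$\gamma(n,k)=\gamma(k,n)=d_k.$$
   Context: $S_m=\{g\in F_r:|g|=m\}$, where $|g|$ is the word length of $g$ with respect to the fixed free generating set, and $UV=\{uv:u\in U,v\in V\}$. *)

theory Defs
  imports Complex_Main "HOL-Algebra.Coset" "HOL-Algebra.Generated_Groups"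
begin

section \<open>Free groups as groups of reduced words\<close>

text \<open>The letter \<open>(x, True)\<close> stands for the generator \<open>x\<close>, the letter \<open>(x, False)\<close> for its inverse.\<close>

type_synonym 'a letter = "'a \<times> bool"

definition inv_letter :: "'a letter \<Rightarrow> 'a letter" where
  "inv_letter a = (fst a, \<not> snd a)"

definition reduced :: "'a letter list \<Rightarrow> bool" where
  "reduced w \<longleftrightarrow> successively (\<lambda>a b. b \<noteq> inv_letter a) w"

text \<open>Left multiplication of a reduced word by one letter, followed by cancellation.\<close>

definition cancel_cons :: "'a letter \<Rightarrow> 'a letter list \<Rightarrow> 'a letter list" where
  "cancel_cons a w = (if w \<noteq> [] \<and> hd w = inv_letter a then tl w else a # w)"

text \<open>The product of two reduced words is the reduced form of their concatenation; it is obtained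
  by letting the letters of the first word act one by one, the last one first.\<close>

definition free_group :: "'a set \<Rightarrow> 'a letter list monoid" where
  "free_group X = \<lparr>carrier = {w. set w \<subseteq> X \<times> UNIV \<and> reduced w},
                   monoid.mult = (\<lambda>u v. foldr cancel_cons u v),
                   one = []\<rparr>"

definition free_gen :: "'a \<Rightarrow> 'a letter list" where
  "free_gen x = [(x, True)]"


section \<open>Word length and spheres\<close>

definition word_length :: "('g, 'm) monoid_scheme \<Rightarrow> 'g set \<Rightarrow> 'g \<Rightarrow> nat" where
  "word_length G B g =
     (LEAST m. \<exists>ws. length ws = m \<and> set ws \<subseteq> B \<union> m_inv G ` B \<and> foldr (\<otimes>\<^bsub>G\<^esub>) ws \<one>\<^bsub>G\<^esub> = g)"

definition sphere :: "('g, 'm) monoid_scheme \<Rightarrow> 'g set \<Rightarrow> nat \<Rightarrow> 'g set" where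
  "sphere G B m = {g \<in> carrier G. word_length G B g = m}"


section \<open>The free group of rank r and the quantity \<open>\<gamma>(n,k)\<close>\<close>

abbreviation F :: "nat \<Rightarrow> nat letter list monoid" where
  "F r \<equiv> free_group {..<r}"

definition S :: "nat \<Rightarrow> nat \<Rightarrow> nat letter list set" where
  "S r m = sphere (F r) (free_gen ` {..<r}) m"

text \<open>The product set \<open>UV\<close> is the library's \<open>U <#> V\<close>. The set of ratios is finite and, for
  \<open>r \<ge> 1\<close>, nonempty (see below), so that \<open>Min\<close> is a genuine minimum.\<close>

definition product_ratios :: "nat \<Rightarrow> nat \<Rightarrow> nat \<Rightarrow> real set" where
  "product_ratios r n k =
     {real (card (U <#>\<^bsub>F r\<^esub> V)) / (real (card U) * real (card V)) | U V.
        U \<noteq> {} \<and> U \<subseteq> S r n \<and> V \<noteq> {} \<and> V \<subseteq> S r k}"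

definition gamma :: "nat \<Rightarrow> nat \<Rightarrow> nat \<Rightarrow> real" where
  "gamma r n k = Min (product_ratios r n k)"


section \<open>Basic facts\<close>

lemma inv_letter_inv [simp]: "inv_letter (inv_letter a) = a"
  by (simp add: inv_letter_def)

lemma inv_letter_neq [simp]: "inv_letter a \<noteq> a" "a \<noteq> inv_letter a"
  by (auto simp: inv_letter_def prod_eq_iff)

lemma inv_letter_in [simp]: "inv_letter a \<in> X \<times> UNIV \<longleftrightarrow> a \<in> X \<times> UNIV"
  by (cases a) (auto simp: inv_letter_def)

lemma reduced_Nil [simp]: "reduced []"
  by (simp add: reduced_def)

lemma reduced_Cons: "reduced (a # w) \<longleftrightarrow> reduced w \<and> (w \<noteq> [] \<longrightarrow> hd w \<noteq> inv_letter a)"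
  by (cases w) (auto simp: reduced_def)

lemma reduced_cancel_cons: "reduced w \<Longrightarrow> reduced (cancel_cons a w)"
  by (cases w) (auto simp: cancel_cons_def reduced_Cons)

lemma cancel_cons_reduced: "reduced (a # w) \<Longrightarrow> cancel_cons a w = a # w"
  by (auto simp: cancel_cons_def reduced_Cons)

lemma cancel_cons_inv: "reduced w \<Longrightarrow> cancel_cons a (cancel_cons (inv_letter a) w) = w"
  by (cases w) (auto simp: cancel_cons_def reduced_Cons)

lemma reduced_foldr: "reduced w \<Longrightarrow> reduced (foldr cancel_cons u w)"
  by (induction u) (auto simp: reduced_cancel_cons)

lemma set_cancel_cons: "set (cancel_cons a w) \<subseteq> insert a (set w)"
  by (cases w) (auto simp: cancel_cons_def)

lemma set_foldr_cancel: "set (foldr cancel_cons u w) \<subseteq> set u \<union> set w"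
  using set_cancel_cons by (induction u) fastforce+

lemma foldr_cancel_Nil: "reduced u \<Longrightarrow> foldr cancel_cons u [] = u"
  by (induction u) (auto simp: reduced_Cons cancel_cons_reduced)

lemma foldr_cancel_cons_step:
  assumes "reduced t" "reduced w"
  shows "foldr cancel_cons (cancel_cons a t) w = cancel_cons a (foldr cancel_cons t w)"
proof (cases "t \<noteq> [] \<and> hd t = inv_letter a")
  case True
  then obtain t' where t: "t = inv_letter a # t'"
    by (cases t) auto
  have "cancel_cons a t = t'"
    by (simp add: t cancel_cons_def)
  then show ?thesis
    using assms by (simp add: t cancel_cons_inv reduced_foldr)
next
  case False
  then have "cancel_cons a t = a # t"
    by (auto simp: cancel_cons_def)
  then show ?thesis
    by simp
qed

lemma foldr_cancel_assoc:
  assumes "reduced v" "reduced w"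
  shows "foldr cancel_cons (foldr cancel_cons u v) w = foldr cancel_cons u (foldr cancel_cons v w)"
  using assms by (induction u) (auto simp: foldr_cancel_cons_step reduced_foldr)

lemma foldr_cancel_inverse:
  "reduced w \<Longrightarrow> foldr cancel_cons (map inv_letter (rev w)) w = []"
proof (induction w)
  case (Cons a w)
  have "cancel_cons (inv_letter a) (a # w) = w"
    by (simp add: cancel_cons_def)
  with Cons show ?case
    by (simp add: reduced_Cons)
qed simp

lemma reduced_inverse: "reduced w \<Longrightarrow> reduced (map inv_letter (rev w))"
  unfolding reduced_def successively_map successively_rev
  by (erule successively_mono) (metis inv_letter_inv)

lemma group_free_group: "group (free_group X)"
proof (rule groupI)
  fix w assume w: "w \<in> carrier (free_group X)"
  have "map inv_letter (rev w) \<in> carrier (free_group X)"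
    using w by (auto simp: free_group_def reduced_inverse inv_letter_def)
  moreover have "map inv_letter (rev w) \<otimes>\<^bsub>free_group X\<^esub> w = \<one>\<^bsub>free_group X\<^esub>"
    using w by (simp add: free_group_def foldr_cancel_inverse)
  ultimately show "\<exists>v\<in>carrier (free_group X). v \<otimes>\<^bsub>free_group X\<^esub> w = \<one>\<^bsub>free_group X\<^esub>"
    by blast
next
  fix u v assume "u \<in> carrier (free_group X)" "v \<in> carrier (free_group X)"
  then show "u \<otimes>\<^bsub>free_group X\<^esub> v \<in> carrier (free_group X)"
    using set_foldr_cancel[of u v] by (auto simp: free_group_def reduced_foldr)
qed (auto simp: free_group_def foldr_cancel_assoc)

lemma free_gen_in_carrier [simp]: "free_gen x \<in> carrier (free_group X) \<longleftrightarrow> x \<in> X"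
  by (simp add: free_gen_def free_group_def reduced_def)

lemma inv_free_gen:
  assumes "x \<in> X"
  shows "inv\<^bsub>free_group X\<^esub> (free_gen x) = [(x, False)]"
  using assms
  by (intro group.inv_equality[OF group_free_group])
     (auto simp: free_gen_def free_group_def reduced_def cancel_cons_def inv_letter_def)

lemma letters_eq:
  "free_gen ` X \<union> m_inv (free_group X) ` (free_gen ` X) = (\<lambda>a. [a]) ` (X \<times> UNIV)"
proof -
  have "m_inv (free_group X) ` (free_gen ` X) = (\<lambda>x. [(x, False)]) ` X"
    by (auto simp: image_image inv_free_gen)
  then show ?thesis
    by (auto simp: free_gen_def UNIV_bool)
qed

lemma word_length_free_group:
  assumes w: "w \<in> carrier (free_group X)"
  shows "word_length (free_group X) (free_gen ` X) w = length w"
  unfolding word_length_def letters_eq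
proof (rule Least_equality)
  have "foldr (\<otimes>\<^bsub>free_group X\<^esub>) (map (\<lambda>a. [a]) w) \<one>\<^bsub>free_group X\<^esub> = foldr cancel_cons w []"
    by (simp add: free_group_def foldr_map comp_def)
  also have "\<dots> = w"
    using w by (simp add: free_group_def foldr_cancel_Nil)
  finally show "\<exists>ws. length ws = length w \<and> set ws \<subseteq> (\<lambda>a. [a]) ` (X \<times> UNIV) \<and>
      foldr (\<otimes>\<^bsub>free_group X\<^esub>) ws \<one>\<^bsub>free_group X\<^esub> = w"
    using w by (intro exI[of _ "map (\<lambda>a. [a]) w"]) (auto simp: free_group_def)
next
  fix m
  assume "\<exists>ws. length ws = m \<and> set ws \<subseteq> (\<lambda>a. [a]) ` (X \<times> UNIV) \<and>
      foldr (\<otimes>\<^bsub>free_group X\<^esub>) ws \<one>\<^bsub>free_group X\<^esub> = w"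
  then obtain ws where ws: "length ws = m" "set ws \<subseteq> (\<lambda>a. [a]) ` (X \<times> UNIV)"
      "foldr (\<otimes>\<^bsub>free_group X\<^esub>) ws \<one>\<^bsub>free_group X\<^esub> = w"
    by blast
  have "length (foldr (\<otimes>\<^bsub>free_group X\<^esub>) ws \<one>\<^bsub>free_group X\<^esub>) \<le> length ws"
    using ws(2)
    by (induction ws) (auto simp: free_group_def cancel_cons_def split: if_splits)
  then show "length w \<le> m"
    using ws by simp
qed

lemma free_group_universal:
  assumes "group H" and f: "f \<in> X \<rightarrow> carrier H"
  shows "\<exists>h \<in> hom (free_group X) H. \<forall>x\<in>X. h (free_gen x) = f x"
proof -
  interpret H: group H by fact
  define val where "val = (\<lambda>a. if snd a then f (fst a) else inv\<^bsub>H\<^esub> f (fst a))"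
  define h where "h = (\<lambda>w. foldr (\<lambda>a y. val a \<otimes>\<^bsub>H\<^esub> y) w \<one>\<^bsub>H\<^esub>)"
  have val: "val a \<in> carrier H" if "a \<in> X \<times> UNIV" for a
    using f that by (auto simp: val_def)
  have val_inv: "val a \<otimes>\<^bsub>H\<^esub> val (inv_letter a) = \<one>\<^bsub>H\<^esub>" if "a \<in> X \<times> UNIV" for a
  proof -
    have "f (fst a) \<in> carrier H"
      using f that by auto
    then show ?thesis
      by (simp add: val_def inv_letter_def)
  qed
  have h: "h w \<in> carrier H" if "set w \<subseteq> X \<times> UNIV" for w
    using that by (induction w) (auto simp: h_def val simp del: mem_Times_iff)
  have h_Cons: "h (a # w) = val a \<otimes>\<^bsub>H\<^esub> h w" for a w
    by (simp add: h_def)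
  have h_cancel: "h (cancel_cons a w) = val a \<otimes>\<^bsub>H\<^esub> h w"
    if a: "a \<in> X \<times> UNIV" and w: "set w \<subseteq> X \<times> UNIV" for a w
  proof (cases "w \<noteq> [] \<and> hd w = inv_letter a")
    case True
    then obtain t where t: "w = inv_letter a # t"
      by (cases w) auto
    have ht: "h t \<in> carrier H"
      using w by (intro h) (simp add: t)
    have "val a \<otimes>\<^bsub>H\<^esub> h w = (val a \<otimes>\<^bsub>H\<^esub> val (inv_letter a)) \<otimes>\<^bsub>H\<^esub> h t"
      unfolding t h_Cons using val[OF a] val[of "inv_letter a"] a ht
      by (subst H.m_assoc) auto
    also have "\<dots> = h t"
      using val_inv[OF a] ht by simp
    finally show ?thesis
      by (simp add: t cancel_cons_def)
  next
    case False
    then show ?thesis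
      by (auto simp: cancel_cons_def h_Cons)
  qed
  have h_mult: "h (foldr cancel_cons u v) = h u \<otimes>\<^bsub>H\<^esub> h v"
    if "set u \<subseteq> X \<times> UNIV" "set v \<subseteq> X \<times> UNIV" for u v
    using that(1)
  proof (induction u)
    case Nil
    then show ?case
      using h[OF that(2)] by (simp add: h_def)
  next
    case (Cons a u)
    have a: "a \<in> X \<times> UNIV" and u: "set u \<subseteq> X \<times> UNIV"
      using Cons.prems by auto
    have "set (foldr cancel_cons u v) \<subseteq> X \<times> UNIV"
      using set_foldr_cancel[of u v] u that(2) by blast
    then show ?case
      using Cons.IH[OF u] val[OF a] h[OF u] h[OF that(2)]
      by (simp add: h_cancel[OF a] h_Cons H.m_assoc)
  qed
  have "h \<in> hom (free_group X) H"
    by (intro homI) (auto simp: free_group_def h h_mult)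
  moreover have "h (free_gen x) = f x" if "x \<in> X" for x
  proof -
    have "f x \<in> carrier H"
      using f that by auto
    then show ?thesis
      by (simp add: h_def val_def free_gen_def)
  qed
  ultimately show ?thesis
    by blast
qed

lemma generate_free_gen: "generate (free_group X) (free_gen ` X) = carrier (free_group X)"
proof
  show "generate (free_group X) (free_gen ` X) \<subseteq> carrier (free_group X)"
    by (intro group.generate_incl[OF group_free_group]) auto
  have "w \<in> generate (free_group X) (free_gen ` X)"
    if "set w \<subseteq> X \<times> UNIV" "reduced w" for w
    using that
  proof (induction w)
    case Nil
    have "\<one>\<^bsub>free_group X\<^esub> \<in> generate (free_group X) (free_gen ` X)"
      by (rule generate.one)
    then show ?case
      by (simp add: free_group_def)
  next
    case (Cons a w)
    have "[a] \<in> free_gen ` X \<union> m_inv (free_group X) ` (free_gen ` X)"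
      using Cons.prems unfolding letters_eq by auto
    then have "[a] \<in> generate (free_group X) (free_gen ` X)"
      by (metis UnE imageE generate.incl generate.inv)
    moreover have "w \<in> generate (free_group X) (free_gen ` X)"
      using Cons by (simp add: reduced_Cons)
    ultimately have "[a] \<otimes>\<^bsub>free_group X\<^esub> w \<in> generate (free_group X) (free_gen ` X)"
      by (rule generate.eng)
    then show ?case
      using Cons.prems by (simp add: free_group_def cancel_cons_reduced)
  qed
  then show "carrier (free_group X) \<subseteq> generate (free_group X) (free_gen ` X)"
    by (auto simp: free_group_def)
qed

lemma S_eq: "S r m = {w. set w \<subseteq> {..<r} \<times> UNIV \<and> reduced w \<and> length w = m}"
proof -
  have "S r m = {w \<in> carrier (F r). length w = m}"
    unfolding S_def sphere_def
    by (intro Collect_cong conj_cong refl) (simp add: word_length_free_group)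
  then show ?thesis
    by (auto simp: free_group_def)
qed

lemma finite_S: "finite (S r m)"
  by (rule finite_subset[OF _ finite_lists_length_eq[of "{..<r} \<times> (UNIV :: bool set)" m]])
     (auto simp: S_eq)

lemma S_nonempty:
  assumes "r \<ge> 1"
  shows "S r m \<noteq> {}"
proof -
  have "reduced (replicate m (0::nat, True))"
    by (induction m) (auto simp: reduced_Cons inv_letter_def hd_replicate)
  then have "replicate m (0, True) \<in> S r m"
    using assms by (auto simp: S_eq)
  then show ?thesis by blast
qed

lemma finite_product_ratios: "finite (product_ratios r n k)"
proof -
  have "product_ratios r n k \<subseteq>
    (\<lambda>(U, V). real (card (U <#>\<^bsub>F r\<^esub> V)) / (real (card U) * real (card V))) `
      (Pow (S r n) \<times> Pow (S r k))"
    unfolding product_ratios_def by auto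
  then show ?thesis
    by (rule finite_subset) (simp add: finite_S)
qed

lemma product_ratios_nonempty: "r \<ge> 1 \<Longrightarrow> product_ratios r n k \<noteq> {}"
  using S_nonempty[of r n] S_nonempty[of r k] unfolding product_ratios_def by blast

end

theory Submission
  imports Defs
begin

text \<open>
  Write \<open>U\<^sub>x = {u. u x \<in> U}\<close> and \<open>V\<^sub>x = {v. x\<inverse> v \<in> V}\<close> (reduced words throughout) for every letter \<open>x\<close>.
  A product \<open>(u x) (y\<inverse> v)\<close> with \<open>x \<noteq> y\<close> is already reduced, so such products have length \<open>n + k\<close> and
  determine their two factors; a product with \<open>x = y\<close> is shorter and lies in \<open>U\<^sub>x V\<^sub>x\<close>. Hence for every
  single letter \<open>x\<close>
    \<open>|UV| \<ge> |U| |V| - (\<Sum>z. |U\<^sub>z| |V\<^sub>z|) + |U\<^sub>x V\<^sub>x|\<close>.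
  By induction on \<open>k\<close>, starting from \<open>V = {1}\<close> with ratio \<open>1\<close>, the last summand is at least \<open>d\<^bsub>k-1\<^esub> |U\<^sub>x| |V\<^sub>x|\<close>. With the densities
  \<open>p\<^sub>x = |U\<^sub>x| / |U|\<close> and \<open>q\<^sub>x = |V\<^sub>x| / |V|\<close>, which both sum to 1, the lower bound reduces to
    \<open>1 - (\<Sum>z. p\<^sub>z q\<^sub>z) + d (max\<^sub>x p\<^sub>x q\<^sub>x) \<ge> 1/2 + d/4\<close> for \<open>2/3 \<le> d \<le> 1\<close>,
  an inequality about the numbers \<open>t\<^sub>x = sqrt (p\<^sub>x q\<^sub>x)\<close>, whose sum is at most 1
  (lemma \<open>overlap_density_bound\<close>). Equality occurs when two letters carry weight \<open>1/2\<close> each, in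
  both sets. Repeating this at every level leads to the extremal sets: \<open>V\<close> consists of the
  inverses of all positive words of length \<open>k\<close> in two generators, and \<open>U\<close> of these positive words
  behind a fixed positive prefix of length \<open>n - k\<close> (lemma \<open>card_positive_product_le\<close>). Inversion of
  group elements exchanges the roles of \<open>n\<close> and \<open>k\<close>.
\<close>

abbreviation words_prod :: "'a letter list set \<Rightarrow> 'a letter list set \<Rightarrow> 'a letter list set" where
  "words_prod U V \<equiv> (\<lambda>(u, v). foldr cancel_cons u v) ` (U \<times> V)"

lemma set_mult_free_group: "U <#>\<^bsub>free_group X\<^esub> V = words_prod U V"
  by (auto simp: set_mult_def free_group_def)


section \<open>Products of reduced words\<close>

lemma reduced_append:
  "reduced (u @ v) \<longleftrightarrow>
     reduced u \<and> reduced v \<and> (u \<noteq> [] \<longrightarrow> v \<noteq> [] \<longrightarrow> hd v \<noteq> inv_letter (last u))"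
  by (auto simp: reduced_def successively_append_iff)

lemma foldr_cancel_append: "reduced (u @ v) \<Longrightarrow> foldr cancel_cons u v = u @ v"
  by (induction u) (auto simp: reduced_Cons cancel_cons_reduced)

lemma length_foldr_cancel_le: "length (foldr cancel_cons u v) \<le> length u + length v"
  by (induction u) (auto simp: cancel_cons_def)

lemma foldr_cancel_snoc_inv:
  "foldr cancel_cons (u @ [x]) (inv_letter x # v) = foldr cancel_cons u v"
  by (simp add: cancel_cons_def)

lemma finite_snoc_quotient: "finite U \<Longrightarrow> finite {u. u @ [x] \<in> U}"
  using finite_vimageI[of U "\<lambda>u. u @ [x]"] by (simp add: vimage_def inj_on_def)

lemma finite_Cons_quotient: "finite V \<Longrightarrow> finite {v. x # v \<in> V}"
  using finite_vimageI[of V "\<lambda>v. x # v"] by (simp add: vimage_def inj_on_def)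

lemma inj_inv_letter: "inj inv_letter"
  by (metis injI inv_letter_inv)


section \<open>The lower bound\<close>

text \<open>The numbers \<open>t\<^sub>x = sqrt (p\<^sub>x q\<^sub>x)\<close> satisfy \<open>t\<^sub>x \<le> (p\<^sub>x + q\<^sub>x) / 2\<close> and therefore sum to at most 1. Let
  \<open>t\<close> be the largest one. If \<open>t \<le> 1/2\<close>, then \<open>\<Sum> t\<^sub>x\<^sup>2 \<le> t \<Sum> t\<^sub>x \<le> t\<close>, and \<open>1 - t + d t\<^sup>2\<close> decreases on
  \<open>[0, 1/2]\<close>. If \<open>t \<ge> 1/2\<close>, then \<open>\<Sum> t\<^sub>x\<^sup>2 \<le> t\<^sup>2 + (1 - t)\<^sup>2\<close>, and \<open>2 t - (2 - d) t\<^sup>2\<close> is concave on \<open>[1/2, 1]\<close>,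
  with the end values \<open>1/2 + d/4\<close> and \<open>d\<close>, and \<open>d \<ge> 1/2 + d/4\<close> since \<open>d \<ge> 2/3\<close>.\<close>

lemma overlap_density_bound:
  fixes p q :: "'i \<Rightarrow> real"
  assumes fin: "finite A"
    and p0: "\<And>x. x \<in> A \<Longrightarrow> 0 \<le> p x" and q0: "\<And>x. x \<in> A \<Longrightarrow> 0 \<le> q x"
    and p1: "sum p A = 1" and q1: "sum q A = 1"
    and d: "2 / 3 \<le> d" "d \<le> 1"
    and c: "\<And>x. x \<in> A \<Longrightarrow> 1 - (\<Sum>z\<in>A. p z * q z) + d * (p x * q x) \<le> c"
  shows "1 / 2 + d / 4 \<le> c"
proof -
  define t where "t x = sqrt (p x * q x)" for x
  have sq: "p x * q x = (t x)\<^sup>2" if "x \<in> A" for x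
    using p0[OF that] q0[OF that] by (simp add: t_def)
  have t0: "0 \<le> t x" if "x \<in> A" for x
    using p0[OF that] q0[OF that] by (simp add: t_def)
  have "sum t A \<le> (\<Sum>x\<in>A. (p x + q x) / 2)"
    unfolding t_def by (intro sum_mono arith_geo_mean_sqrt p0 q0)
  also have "\<dots> = 1"
    by (simp add: sum_divide_distrib[symmetric] sum.distrib p1 q1)
  finally have t1: "sum t A \<le> 1" .
  have "A \<noteq> {}"
    using p1 by auto
  then have "Max (t ` A) \<in> t ` A"
    using fin by (intro Max_in) auto
  then obtain x where x: "x \<in> A" and "Max (t ` A) = t x"
    by blast
  then have max: "t z \<le> t x" if "z \<in> A" for z
    using fin that by (metis Max_ge finite_imageI imageI)
  define s where "s = t x"
  define R where "R = sum t (A - {x})"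
  have split_t: "sum t A = s + R"
    using fin x by (simp add: s_def R_def sum.remove)
  have R0: "0 \<le> R"
    unfolding R_def by (intro sum_nonneg t0) auto
  have Q: "(\<Sum>z\<in>A. (t z)\<^sup>2) = s\<^sup>2 + (\<Sum>z\<in>A - {x}. (t z)\<^sup>2)"
    using fin x by (simp add: s_def sum.remove)
  have rest_max: "(\<Sum>z\<in>A - {x}. (t z)\<^sup>2) \<le> s * R"
    unfolding R_def sum_distrib_left s_def
    by (intro sum_mono) (auto simp: power2_eq_square intro!: mult_right_mono max t0)
  have rest_self: "(\<Sum>z\<in>A - {x}. (t z)\<^sup>2) \<le> R * R"
    unfolding R_def sum_distrib_left
  proof (intro sum_mono)
    fix z assume z: "z \<in> A - {x}"
    then have "t z \<le> sum t (A - {x})"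
      using fin t0 by (intro member_le_sum) auto
    then show "(t z)\<^sup>2 \<le> sum t (A - {x}) * t z"
      using t0[of z] z by (auto simp: power2_eq_square intro: mult_right_mono)
  qed
  have s0: "0 \<le> s"
    using t0[OF x] by (simp add: s_def)
  have s1: "R \<le> 1 - s" "s \<le> 1"
    using t1 split_t R0 by auto
  have c': "1 - (\<Sum>z\<in>A. (t z)\<^sup>2) + d * s\<^sup>2 \<le> c"
    using c[OF x] sq by (simp add: s_def x)
  show ?thesis
  proof (cases "s \<le> 1 / 2")
    case True
    have "s * R \<le> s * (1 - s)"
      using s0 s1 by (intro mult_left_mono) auto
    then have "(\<Sum>z\<in>A. (t z)\<^sup>2) \<le> s"
      using Q rest_max by (simp add: power2_eq_square algebra_simps)
    \<comment> \<open>The difference of \<open>1 - s + d s\<^sup>2\<close> and its value at \<open>1/2\<close> is \<open>(1/2 - s) (1 - d (1/2 + s))\<close>.\<close>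
    moreover have "0 \<le> (1 / 2 - s) * (1 - d * (1 / 2 + s))"
      using True s0 d by (intro mult_nonneg_nonneg) (auto intro!: mult_le_one)
    ultimately show ?thesis
      using c' by (simp add: power2_eq_square algebra_simps)
  next
    case False
    have "R * R \<le> (1 - s) * (1 - s)"
      using R0 s1 by (intro mult_mono) auto
    then have "(\<Sum>z\<in>A. (t z)\<^sup>2) \<le> s\<^sup>2 + (1 - s) * (1 - s)"
      using Q rest_self by linarith
    \<comment> \<open>The difference of \<open>2 s - (2 - d) s\<^sup>2\<close> and its value at \<open>1/2\<close> is
      \<open>(s - 1/2) (2 - (2 - d) (s + 1/2))\<close>; the second factor is smallest at \<open>s = 1\<close>.\<close>
    moreover have "(2 - d) * (s + 1 / 2) \<le> (2 - d) * (3 / 2)"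
      using s1 d by (intro mult_left_mono) auto
    then have "0 \<le> (s - 1 / 2) * (2 - (2 - d) * (s + 1 / 2))"
      using False d by (intro mult_nonneg_nonneg) auto
    then have "1 / 2 + d / 4 \<le> 2 * s - (2 - d) * s\<^sup>2"
      by (simp add: power2_eq_square field_simps)
    ultimately show ?thesis
      using c' by (simp add: power2_eq_square algebra_simps)
  qed
qed

text \<open>The three terms count the pairs of factors without cancellation, which are recovered from their
  products of full length by cutting after \<open>n + 1\<close> letters, and the shorter products coming from one
  cancelling letter.\<close>

lemma card_words_prod_ge:
  fixes U V :: "'a letter list set" and n k :: nat
  defines "Ux \<equiv> \<lambda>x. {u. u @ [x] \<in> U}" and "Vx \<equiv> \<lambda>x. {v. inv_letter x # v \<in> V}"
  assumes finU: "finite U" and finV: "finite V"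
    and U: "\<And>u. u \<in> U \<Longrightarrow> reduced u \<and> length u = Suc n"
    and V: "\<And>v. v \<in> V \<Longrightarrow> reduced v \<and> length v = Suc k"
    and A: "finite A" "last ` U \<subseteq> A"
  shows "card U * card V + card (words_prod (Ux x) (Vx x)) \<le>
         card (words_prod U V) + (\<Sum>z\<in>A. card (Ux z) * card (Vx z))"
proof -
  define C where "C = {(u, v) \<in> U \<times> V. hd v = inv_letter (last u)}"
  define N where "N = U \<times> V - C"
  define g :: "'a letter list \<times> 'a letter list \<Rightarrow> _" where "g = (\<lambda>(u, v). foldr cancel_cons u v)"
  have finUx: "finite (Ux z)" for z
    unfolding Ux_def by (rule finite_snoc_quotient[OF finU])
  have finVx: "finite (Vx z)" for z
    unfolding Vx_def by (rule finite_Cons_quotient[OF finV])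
  have nonempty: "u \<noteq> []" if "u \<in> U \<or> u \<in> V" for u
    using U V that by fastforce
  have gN: "g (u, v) = u @ v" if "(u, v) \<in> N" for u v
  proof -
    have "reduced (u @ v)"
      using that U V by (auto simp: N_def C_def reduced_append)
    then show ?thesis
      by (simp add: g_def foldr_cancel_append)
  qed
  have inj: "inj_on g N"
  proof (rule inj_onI)
    fix a b assume ab: "a \<in> N" "b \<in> N" "g a = g b"
    obtain u v u' v' where uv: "a = (u, v)" "b = (u', v')"
      by (cases a, cases b)
    have "length u = length u'"
      using ab U unfolding uv by (auto simp: N_def)
    then show "a = b"
      using ab unfolding uv by (simp add: gN)
  qed
  have long: "length w = Suc n + Suc k" if "w \<in> g ` N" for w
    using that gN U V by (auto simp: N_def)
  have short: "length w \<le> n + k" if "w \<in> words_prod (Ux x) (Vx x)" for w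
  proof -
    from that obtain u v where uv: "w = foldr cancel_cons u v" "u @ [x] \<in> U" "inv_letter x # v \<in> V"
      by (auto simp: Ux_def Vx_def)
    then show ?thesis
      using length_foldr_cancel_le[of u v] U[OF uv(2)] V[OF uv(3)] by simp
  qed
  have short_sub: "words_prod (Ux x) (Vx x) \<subseteq> words_prod U V"
  proof
    fix w assume "w \<in> words_prod (Ux x) (Vx x)"
    then obtain u v where uv: "w = foldr cancel_cons u v" "u @ [x] \<in> U" "inv_letter x # v \<in> V"
      by (auto simp: Ux_def Vx_def)
    then have "w = foldr cancel_cons (u @ [x]) (inv_letter x # v)"
      by (simp only: foldr_cancel_snoc_inv)
    then show "w \<in> words_prod U V"
      using uv by (intro image_eqI[of _ _ "(u @ [x], inv_letter x # v)"]) auto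
  qed
  have "card N + card (words_prod (Ux x) (Vx x)) = card (g ` N \<union> words_prod (Ux x) (Vx x))"
  proof (subst card_Un_disjoint)
    show "finite (g ` N)" "finite (words_prod (Ux x) (Vx x))"
      using finU finV finUx finVx by (auto simp: N_def)
    show "g ` N \<inter> words_prod (Ux x) (Vx x) = {}"
      using long short by fastforce
  qed (simp add: card_image[OF inj])
  also have "\<dots> \<le> card (words_prod U V)"
    using short_sub finU finV by (intro card_mono) (auto simp: g_def N_def)
  finally have prod: "card N + card (words_prod (Ux x) (Vx x)) \<le> card (words_prod U V)" .
  have "card U * card V = card C + card N"
  proof -
    have "card (U \<times> V) = card (C \<union> N)"
      by (rule arg_cong[of _ _ card]) (auto simp: C_def N_def)
    also have "\<dots> = card C + card N"
      using finU finV
      by (intro card_Un_disjoint) (auto simp: N_def C_def intro: finite_subset[of _ "U \<times> V"])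
    finally show ?thesis
      by (simp add: card_cartesian_product)
  qed
  moreover have "card C \<le> (\<Sum>z\<in>A. card (Ux z) * card (Vx z))"
  proof -
    have "C \<subseteq> (\<Union>z\<in>A. (\<lambda>(u, v). (u @ [z], inv_letter z # v)) ` (Ux z \<times> Vx z))"
    proof safe
      fix u v assume "(u, v) \<in> C"
      then have uv: "u \<in> U" "v \<in> V" "hd v = inv_letter (last u)"
        by (auto simp: C_def)
      then have "u = butlast u @ [last u]" "v = inv_letter (last u) # tl v"
        using nonempty by (metis append_butlast_last_id, metis list.collapse)
      with uv A show "(u, v) \<in> (\<Union>z\<in>A.
          (\<lambda>(u, v). (u @ [z], inv_letter z # v)) ` (Ux z \<times> Vx z))"
        by (intro UN_I[of "last u"] image_eqI[of _ _ "(butlast u, tl v)"])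
           (auto simp: Ux_def Vx_def)
    qed
    then have "card C \<le> card (\<Union>z\<in>A.
        (\<lambda>(u, v). (u @ [z], inv_letter z # v)) ` (Ux z \<times> Vx z))"
      using A finU finUx finVx by (intro card_mono) auto
    also have "\<dots> \<le> (\<Sum>z\<in>A.
        card ((\<lambda>(u, v). (u @ [z], inv_letter z # v)) ` (Ux z \<times> Vx z)))"
      using A finU by (intro card_UN_le) auto
    also have "\<dots> \<le> (\<Sum>z\<in>A. card (Ux z) * card (Vx z))"
      using finUx finVx
      by (intro sum_mono) (metis card_cartesian_product card_image_le finite_cartesian_product)
    finally show ?thesis .
  qed
  ultimately show ?thesis
    using prod by linarith
qed

text \<open>Both densities below sum to 1 over the letters that end a word of \<open>U\<close> or whose inverses start
  a word of \<open>V\<close>, because every nonempty word is counted under exactly one letter.\<close>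

lemma card_words_prod_lower_bound:
  fixes U V :: "'a letter list set"
  assumes "finite U" "finite V" "k \<le> n"
    and "\<And>u. u \<in> U \<Longrightarrow> reduced u \<and> length u = n"
    and "\<And>v. v \<in> V \<Longrightarrow> reduced v \<and> length v = k"
  shows "(2 + 1 / 4 ^ k) / 3 * (real (card U) * real (card V)) \<le> real (card (words_prod U V))"
  using assms
proof (induction k arbitrary: n U V)
  case 0
  show ?case
  proof (cases "V = {}")
    case False
    then have V: "V = {[]}"
      using "0.prems"(5) by auto
    have "words_prod U V = U"
      using "0.prems"(4) by (force simp: V foldr_cancel_Nil)
    then show ?thesis
      by (simp add: V)
  qed simp
next
  case (Suc k m)
  then obtain n where m: "m = Suc n" and kn: "k \<le> n"
    by (cases m) auto
  define d :: real where "d = (2 + 1 / 4 ^ k) / 3"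
  define Ux where "Ux x = {u. u @ [x] \<in> U}" for x
  define Vx where "Vx x = {v. inv_letter x # v \<in> V}" for x
  define A where "A = last ` U \<union> inv_letter ` hd ` V"
  have U: "reduced u \<and> length u = Suc n" if "u \<in> U" for u
    using Suc.prems that m by blast
  have V: "reduced v \<and> length v = Suc k" if "v \<in> V" for v
    using Suc.prems that by blast
  have A: "finite A"
    using Suc.prems by (simp add: A_def)
  have finUx: "finite (Ux z)" for z
    unfolding Ux_def by (rule finite_snoc_quotient[OF Suc.prems(1)])
  have finVx: "finite (Vx z)" for z
    unfolding Vx_def by (rule finite_Cons_quotient[OF Suc.prems(2)])
  have sumU: "card U = (\<Sum>z\<in>A. card (Ux z))"
  proof -
    have "U = (\<Union>z\<in>A. (\<lambda>u. u @ [z]) ` Ux z)"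
    proof (intro equalityI subsetI)
      fix u assume u: "u \<in> U"
      then have "u = butlast u @ [last u]"
        using U[OF u] by (metis append_butlast_last_id length_0_conv nat.distinct(1))
      with u show "u \<in> (\<Union>z\<in>A. (\<lambda>u. u @ [z]) ` Ux z)"
        by (intro UN_I[of "last u"] image_eqI[of _ _ "butlast u"]) (auto simp: A_def Ux_def)
    qed (auto simp: Ux_def)
    also have "card \<dots> = (\<Sum>z\<in>A. card ((\<lambda>u. u @ [z]) ` Ux z))"
      using A finUx by (intro card_UN_disjoint) auto
    also have "\<dots> = (\<Sum>z\<in>A. card (Ux z))"
      by (intro sum.cong refl card_image) (simp add: inj_on_def)
    finally show ?thesis .
  qed
  have sumV: "card V = (\<Sum>z\<in>A. card (Vx z))"
  proof -
    have "V = (\<Union>z\<in>A. (\<lambda>v. inv_letter z # v) ` Vx z)"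
    proof (intro equalityI subsetI)
      fix v assume v: "v \<in> V"
      then have "v = hd v # tl v"
        using V[OF v] by (cases v) auto
      with v show "v \<in> (\<Union>z\<in>A. (\<lambda>v. inv_letter z # v) ` Vx z)"
        by (intro UN_I[of "inv_letter (hd v)"] image_eqI[of _ _ "tl v"]) (auto simp: A_def Vx_def)
    qed (auto simp: Vx_def)
    also have "card \<dots> = (\<Sum>z\<in>A. card ((\<lambda>v. inv_letter z # v) ` Vx z))"
      using A finVx by (intro card_UN_disjoint) (auto dest: injD[OF inj_inv_letter])
    also have "\<dots> = (\<Sum>z\<in>A. card (Vx z))"
      by (intro sum.cong refl card_image) (simp add: inj_on_def)
    finally show ?thesis .
  qed
  show ?case
  proof (cases "U = {} \<or> V = {}")
    case False
    then have pos: "0 < real (card U)" "0 < real (card V)"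
      using Suc.prems by (auto simp: card_gt_0_iff)
    define uv where "uv = real (card U) * real (card V)"
    have uv: "0 < uv"
      using pos by (simp add: uv_def)
    have scale: "real (card (Ux z)) / real (card U) * (real (card (Vx z)) / real (card V)) =
        real (card (Ux z)) * real (card (Vx z)) / uv" for z
      by (simp add: uv_def)
    have "1 / 2 + d / 4 \<le> real (card (words_prod U V)) / uv"
    proof (rule overlap_density_bound[where A = A and p = "\<lambda>z. real (card (Ux z)) / real (card U)"
          and q = "\<lambda>z. real (card (Vx z)) / real (card V)"], goal_cases)
      case 4
      show ?case
        using pos by (simp add: sum_divide_distrib[symmetric] sumU flip: of_nat_sum)
    next
      case 5
      show ?case
        using pos by (simp add: sum_divide_distrib[symmetric] sumV flip: of_nat_sum)
    next
      case (8 x)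
      have "d * (real (card (Ux x)) * real (card (Vx x))) \<le> real (card (words_prod (Ux x) (Vx x)))"
        unfolding d_def
      proof (rule Suc.IH[OF finUx finVx kn])
        show "reduced u \<and> length u = n" if "u \<in> Ux x" for u
          using that U[of "u @ [x]"] by (simp add: Ux_def reduced_append)
        show "reduced v \<and> length v = k" if "v \<in> Vx x" for v
          using that V[of "inv_letter x # v"] by (simp add: Vx_def reduced_Cons)
      qed
      moreover have "uv + real (card (words_prod (Ux x) (Vx x))) \<le>
          real (card (words_prod U V)) + (\<Sum>z\<in>A. real (card (Ux z)) * real (card (Vx z)))"
        using card_words_prod_ge[OF Suc.prems(1,2) U V A, of x]
        unfolding Ux_def[symmetric] Vx_def[symmetric] uv_def
        by (simp add: A_def flip: of_nat_mult of_nat_add of_nat_sum)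
      ultimately have "uv - (\<Sum>z\<in>A. real (card (Ux z)) * real (card (Vx z))) +
          d * (real (card (Ux x)) * real (card (Vx x))) \<le> real (card (words_prod U V))"
        by linarith
      then have "(uv - (\<Sum>z\<in>A. real (card (Ux z)) * real (card (Vx z))) +
          d * (real (card (Ux x)) * real (card (Vx x)))) / uv \<le> real (card (words_prod U V)) / uv"
        using uv by (intro divide_right_mono) auto
      then show ?case
        unfolding scale sum_divide_distrib[symmetric]
        using uv by (simp add: add_divide_distrib diff_divide_distrib)
    qed (use A in \<open>auto simp: d_def field_simps\<close>)
    then have "(1 / 2 + d / 4) * uv \<le> real (card (words_prod U V))"
      using uv by (simp add: field_simps)
    moreover have "(2 + 1 / 4 ^ Suc k) / 3 = 1 / 2 + d / 4"
      by (simp add: d_def field_simps)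
    ultimately show ?thesis
      by (simp only: uv_def)
  qed auto
qed


section \<open>Extremal sets\<close>

lemma reduced_positive: "(\<And>a. a \<in> set w \<Longrightarrow> snd a) \<Longrightarrow> reduced w"
proof (induction w)
  case (Cons a w)
  have "hd w \<noteq> inv_letter a" if "w \<noteq> []"
    using Cons.prems[of a] Cons.prems[of "hd w"] that by (auto simp: inv_letter_def)
  moreover have "reduced w"
    by (rule Cons.IH) (simp add: Cons.prems)
  ultimately show ?case
    by (simp add: reduced_Cons)
qed simp

text \<open>Two positive words of length \<open>k + 1\<close> with the same last letter give a product that already
  occurs for \<open>k\<close>, and there are \<open>2 \<cdot> 4\<^sup>k\<close> pairs with different last letters; the bound is the
  solution of \<open>c\<^sub>0 = 1\<close>, \<open>c\<^bsub>k+1\<^esub> = c\<^sub>k + 2 \<cdot> 4\<^sup>k\<close>. An estimate from above is enough here,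
  because the lower bound excludes smaller ratios.\<close>

lemma card_positive_product_le:
  fixes a b :: "'a letter" and w\<^sub>0 :: "'a letter list"
  assumes ab: "a \<noteq> b"
  defines "P \<equiv> \<lambda>k. {w. set w \<subseteq> {a, b} \<and> length w = k}"
  shows "3 * card (words_prod ((@) w\<^sub>0 ` P k) ((\<lambda>w. map inv_letter (rev w)) ` P k)) \<le> 2 * 4 ^ k + 1"
proof -
  define T where "T k = (\<lambda>(w, z). foldr cancel_cons (w\<^sub>0 @ w) (map inv_letter (rev z))) ` (P k \<times> P k)"
    for k
  have finP: "finite (P k)" for k
    unfolding P_def by (rule finite_lists_length_eq) simp
  have cardP: "card (P k) = 2 ^ k" for k
    unfolding P_def using ab by (subst card_lists_length_eq) (auto simp: numeral_2_eq_2)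
  have T: "words_prod ((@) w\<^sub>0 ` P k) ((\<lambda>w. map inv_letter (rev w)) ` P k) = T k" for k
    unfolding T_def by (force simp: image_iff)
  have snoc: "\<exists>w' x. w = w' @ [x] \<and> w' \<in> P k \<and> x \<in> {a, b}" if "w \<in> P (Suc k)" for w k
    using that by (cases w rule: rev_cases) (auto simp: P_def)
  have "3 * card (T k) \<le> 2 * 4 ^ k + 1"
  proof (induction k)
    case 0
    have "P 0 = {[]}"
      by (auto simp: P_def)
    then show ?case
      by (simp add: T_def)
  next
    case (Suc k)
    define h where "h = (\<lambda>((w, z), (x, y)).
      foldr cancel_cons (w\<^sub>0 @ w @ [x]) (map inv_letter (rev (z @ [y]))))"
    have "T (Suc k) \<subseteq> T k \<union> h ` ((P k \<times> P k) \<times> {(a, b), (b, a)})"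
    proof
      fix v assume "v \<in> T (Suc k)"
      then obtain w z where v: "w \<in> P (Suc k)" "z \<in> P (Suc k)"
          "v = foldr cancel_cons (w\<^sub>0 @ w) (map inv_letter (rev z))"
        by (auto simp: T_def)
      obtain w' x z' y where wz: "w = w' @ [x]" "w' \<in> P k" "x \<in> {a, b}"
          "z = z' @ [y]" "z' \<in> P k" "y \<in> {a, b}"
        using snoc[OF v(1)] snoc[OF v(2)] by blast
      show "v \<in> T k \<union> h ` ((P k \<times> P k) \<times> {(a, b), (b, a)})"
      proof (cases "x = y")
        case True
        then have "v = foldr cancel_cons (w\<^sub>0 @ w') (map inv_letter (rev z'))"
          using foldr_cancel_snoc_inv[of "w\<^sub>0 @ w'" x] by (simp add: v wz)
        then show ?thesis
          using wz by (auto simp: T_def)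
      next
        case False
        then have "((w', z'), (x, y)) \<in> (P k \<times> P k) \<times> {(a, b), (b, a)}"
          using wz by auto
        moreover have "v = h ((w', z'), (x, y))"
          by (simp add: h_def v wz)
        ultimately show ?thesis
          by blast
      qed
    qed
    then have "card (T (Suc k)) \<le> card (T k \<union> h ` ((P k \<times> P k) \<times> {(a, b), (b, a)}))"
      using finP by (intro card_mono) (auto simp: T_def)
    also have "\<dots> \<le> card (T k) + card (h ` ((P k \<times> P k) \<times> {(a, b), (b, a)}))"
      by (rule card_Un_le)
    also have "card (h ` ((P k \<times> P k) \<times> {(a, b), (b, a)})) \<le>
        card ((P k \<times> P k) \<times> {(a, b), (b, a)})"
      using finP by (intro card_image_le) auto
    also have "\<dots> = 2 * 4 ^ k"
      using ab by (simp add: card_cartesian_product cardP flip: power_mult_distrib)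
    finally show ?case
      using Suc.IH by simp
  qed
  then show ?thesis
    by (simp add: T)
qed


section \<open>The minimum ratio\<close>

lemma inv_free_group:
  assumes "w \<in> carrier (free_group X)"
  shows "inv\<^bsub>free_group X\<^esub> w = map inv_letter (rev w)"
  using assms
  by (intro group.inv_equality[OF group_free_group])
     (auto simp: free_group_def foldr_cancel_inverse reduced_inverse inv_letter_def)

lemma S_subset_carrier: "S r m \<subseteq> carrier (F r)"
  by (auto simp: S_def sphere_def)

lemma inv_image_S: "w \<in> S r m \<Longrightarrow> inv\<^bsub>F r\<^esub> w \<in> S r m"
  using S_subset_carrier[of r m]
  by (subst inv_free_group) (auto simp: S_eq reduced_inverse inv_letter_def)

text \<open>Inversion maps spheres to themselves and turns \<open>UV\<close> into the product of \<open>V\<inverse>\<close> and \<open>U\<inverse>\<close>.\<close>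

lemma product_ratios_subset_commute: "product_ratios r n k \<subseteq> product_ratios r k n"
proof
  interpret F: group "F r"
    by (rule group_free_group)
  let ?i = "m_inv (F r)"
  fix c assume "c \<in> product_ratios r n k"
  then obtain U V where c: "c = real (card (U <#>\<^bsub>F r\<^esub> V)) / (real (card U) * real (card V))"
    and U: "U \<noteq> {}" "U \<subseteq> S r n" and V: "V \<noteq> {}" "V \<subseteq> S r k"
    by (auto simp: product_ratios_def)
  have sub: "U \<subseteq> carrier (F r)" "V \<subseteq> carrier (F r)"
    using U V S_subset_carrier by blast+
  have card: "card (?i ` W) = card W" if "W \<subseteq> carrier (F r)" for W
    using that by (intro card_image inj_on_subset[OF F.inv_inj])
  have "?i ` V <#>\<^bsub>F r\<^esub> ?i ` U = (\<Union>v\<in>V. \<Union>u\<in>U. {?i v \<otimes>\<^bsub>F r\<^esub> ?i u})"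
    by (auto simp: set_mult_def)
  also have "\<dots> = (\<Union>v\<in>V. \<Union>u\<in>U. {?i (u \<otimes>\<^bsub>F r\<^esub> v)})"
    using sub by (intro SUP_cong refl) (auto simp: F.inv_mult_group subset_iff)
  also have "\<dots> = ?i ` (U <#>\<^bsub>F r\<^esub> V)"
    by (auto simp: set_mult_def)
  finally have "card (?i ` V <#>\<^bsub>F r\<^esub> ?i ` U) = card (U <#>\<^bsub>F r\<^esub> V)"
    using card[OF F.set_mult_closed[OF sub]] by simp
  then have "c = real (card (?i ` V <#>\<^bsub>F r\<^esub> ?i ` U)) / (real (card (?i ` V)) * real (card (?i ` U)))"
    using c card sub by simp
  moreover have "?i ` V \<noteq> {}" "?i ` V \<subseteq> S r k" "?i ` U \<noteq> {}" "?i ` U \<subseteq> S r n"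
    using U V inv_image_S by auto
  ultimately show "c \<in> product_ratios r k n"
    unfolding product_ratios_def by blast
qed

lemma gamma_commute: "gamma r n k = gamma r k n"
  unfolding gamma_def using product_ratios_subset_commute
  by (metis subset_antisym)

lemma product_ratio_ge:
  assumes "k \<le> n" "c \<in> product_ratios r n k"
  shows "(2 + 1 / 4 ^ k) / 3 \<le> c"
proof -
  obtain U V where c: "c = real (card (words_prod U V)) / (real (card U) * real (card V))"
    and U: "U \<noteq> {}" "U \<subseteq> S r n" and V: "V \<noteq> {}" "V \<subseteq> S r k"
    using assms(2) by (auto simp: product_ratios_def set_mult_free_group)
  have fin: "finite U" "finite V"
    using U V finite_S finite_subset by blast+
  have "0 < real (card U) * real (card V)"
    using U V fin by (simp add: card_gt_0_iff)
  moreover have "(2 + 1 / 4 ^ k) / 3 * (real (card U) * real (card V)) \<le>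
      real (card (words_prod U V))"
    using U V by (intro card_words_prod_lower_bound[OF fin assms(1)]) (auto simp: S_eq)
  ultimately show ?thesis
    unfolding c by (simp only: pos_le_divide_eq)
qed

lemma product_ratio_attained_le:
  assumes "r \<ge> 2" "k \<le> n"
  shows "\<exists>c\<in>product_ratios r n k. c \<le> (2 + 1 / 4 ^ k) / 3"
proof -
  define a b :: "nat letter" where "a = (0, True)" and "b = (1, True)"
  define P where "P = {w. set w \<subseteq> {a, b} \<and> length w = k}"
  define U where "U = (@) (replicate (n - k) a) ` P"
  define V where "V = (\<lambda>w. map inv_letter (rev w)) ` P"
  have "card P = 2 ^ k"
    unfolding P_def by (subst card_lists_length_eq) (auto simp: a_def b_def numeral_2_eq_2)
  moreover have "inj_on (\<lambda>w. map inv_letter (rev w)) P"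
    by (rule inj_onI) (simp add: inj_map_eq_map[OF inj_inv_letter])
  ultimately have card: "card U = 2 ^ k" "card V = 2 ^ k"
    unfolding U_def V_def by (simp_all add: card_image inj_on_def[of "(@) (replicate (n - k) a)"])
  have P: "set w \<subseteq> {..<r} \<times> UNIV" "length w = k" "\<And>x. x \<in> set w \<Longrightarrow> snd x" if "w \<in> P" for w
    using that assms(1) by (auto simp: P_def a_def b_def)
  have "replicate (n - k) a @ w \<in> S r n" if w: "w \<in> P" for w
    unfolding S_eq using P[OF w] assms by (auto simp: a_def intro!: reduced_positive)
  then have subU: "U \<subseteq> S r n"
    by (auto simp: U_def)
  have "w \<in> S r k" if w: "w \<in> P" for w
    unfolding S_eq using P[OF w] by (auto intro!: reduced_positive)
  then have subV: "V \<subseteq> S r k"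
    by (force simp: V_def S_eq reduced_inverse inv_letter_def)
  have "3 * card (words_prod U V) \<le> 2 * 4 ^ k + 1"
    unfolding U_def V_def P_def
    by (rule card_positive_product_le) (simp add: a_def b_def)
  then have "3 * real (card (words_prod U V)) \<le> 2 * 4 ^ k + 1"
    by (metis (mono_tags) of_nat_1 of_nat_add of_nat_le_iff of_nat_mult of_nat_numeral of_nat_power)
  then have "real (card (words_prod U V)) / (real (card U) * real (card V)) \<le> (2 + 1 / 4 ^ k) / 3"
    by (simp add: card field_simps flip: power_mult_distrib)
  moreover have "U \<noteq> {}" "V \<noteq> {}"
    using card by auto
  ultimately show ?thesis
    using subU subV unfolding product_ratios_def set_mult_free_group by blast
qed

theorem theorem5p6:
  fixes r :: nat and d :: "nat \<Rightarrow> real"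
  assumes "r \<ge> 2"
    and "d 0 = 1"
    and "\<And>j. j \<ge> 1 \<Longrightarrow> d j = 1 / 2 + d (j - 1) / 4"
  shows "(\<forall>j. d j = (2 + 1 / 4 ^ j) / 3) \<and>
         (\<forall>n k. k \<le> n \<longrightarrow> gamma r n k = d k \<and> gamma r k n = d k)"
proof -
  have d: "d j = (2 + 1 / 4 ^ j) / 3" for j
  proof (induction j)
    case 0
    show ?case
      by (simp add: assms(2))
  next
    case (Suc j)
    moreover have "d (Suc j) = 1 / 2 + d j / 4"
      using assms(3)[of "Suc j"] by simp
    ultimately show ?case
      by (simp add: add_divide_distrib)
  qed
  have "gamma r n k = d k" if kn: "k \<le> n" for n k
  proof (rule antisym)
    obtain c where "c \<in> product_ratios r n k" "c \<le> d k"
      using product_ratio_attained_le[OF assms(1) kn] d by auto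
    then show "gamma r n k \<le> d k"
      unfolding gamma_def using Min_le[OF finite_product_ratios] by (meson order_trans)
    have "product_ratios r n k \<noteq> {}"
      using assms(1) by (intro product_ratios_nonempty) simp
    then show "d k \<le> gamma r n k"
      unfolding gamma_def d by (intro Min.boundedI finite_product_ratios product_ratio_ge[OF kn])
  qed
  then show ?thesis
    using d gamma_commute by metis
qed

end
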